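(* Let $\mathcal{Q}=\{\mathrm{Ber}(p)^\infty:p\in[0,1]\}$. Every $\mathcal{Q}$-NSM is also a $\mathcal{P}_1$-NSM. In fact, every $\mathcal{Q}$-NSM is also a $\mathcal{P}_k$-NSM for every $k\in\mathbb{N}$, and is also a $\mathcal{P}$-NSM for any set $\mathcal{P}$ of laws over infinite binary sequences. In other words, a $\mathcal{Q}$-safe e-process with nontrivial power cannot be a $\mathcal{Q}$-NSM, since a $\mathcal{Q}$-NSM is powerless against any alternative: if $(M_t)$ is a $\mathcal{Q}$-NSM, then for every law $\mathtt{P}$ over infinite binary sequences and every $\alpha\in(0,1)$, $\mathtt{P}(\inf\{t\ge1:M_t\ge 1/\alpha\}<\infty)\le\alpha$.
   Context: The data $(X_t)_{t\ge1}$ are the coordinates on $\{0,1\}^{\mathbb{N}}$; $\mathcal{F}_0$ is trivial and $\mathcal{F}_t=\sigma(X_1,\dots,X_t)$. For a law $\mathtt{Q}$, a $\mathtt{Q}$-NSM is a process $(M_t)_{t\ge0}$ adapted to $(\mathcal{F}_t)$, nonnegative, with $M_0=1$ and $\mathbb{E}_{\mathtt{Q}}[M_t\mid\mathcal{F}_s]\le M_s$ for all $s\le t$. For a set $\mathcal{Q}$ of laws, a $\mathcal{Q}$-NSM is a process that is a $\mathtt{Q}$-NSM simultaneously for every $\mathtt{Q}\in\mathcal{Q}$. A $\mathcal{Q}$-safe e-process is a nonnegative adapted process $(E_t)_{t\ge0}$ with $\sup_{\mathtt{Q}\in\mathcal{Q}}\sup_\tau\mathbb{E}_{\mathtt{Q}}[E_\tau]\le1$,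 where $\tau$ ranges over all, possibly infinite, stopping times and $E_\infty:=\limsup_{t\to\infty}E_t$. Its associated level $\alpha$ sequential test is $\kappa_\alpha=\inf\{t\ge1:E_t\ge1/\alpha\}$. It has nontrivial power if $\mathtt{P}(\kappa_\alpha<\infty)>\alpha$ for some law $\mathtt{P}$ over infinite binary sequences and some $\alpha\in(0,1)$; it is powerless against a law $\mathtt{P}$ if $\mathtt{P}(\kappa_\alpha<\infty)\le\alpha$ for all $\alpha\in(0,1)$. $\mathcal{P}_k$ is the set of laws of time-homogeneous $k$-th order Markov processes with values in $\{0,1\}$. *)

theory Defs
  imports "HOL-Probability.Probability"
begin

text \<open>
  Binary sequences have type \<open>nat \<Rightarrow> bool\<close>, with \<open>False\<close>, \<open>True\<close> encoding 0, 1. The coordinates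
  are numbered from 1, so \<open>X t\<close> reads position \<open>t - 1\<close>; \<open>X 0\<close> is never used.
\<close>

definition seq_space :: "(nat \<Rightarrow> bool) measure" where
  "seq_space = (\<Pi>\<^sub>M i\<in>UNIV. count_space UNIV)"

definition laws :: "(nat \<Rightarrow> bool) measure set" where
  "laws = {Q. prob_space Q \<and> sets Q = sets seq_space}"

definition X :: "nat \<Rightarrow> (nat \<Rightarrow> bool) \<Rightarrow> bool" where
  "X t \<omega> = \<omega> (t - 1)"

text \<open>
  Indexing the natural filtration by \<^typ>\<open>enat\<close>, with \<open>\<F> \<infinity>\<close> generated by all coordinates, makes
  \<^const>\<open>stopping_time\<close> applicable to possibly infinite stopping times: its condition at \<open>\<infinity>\<close> is
  vacuous. \<open>\<F> 0\<close> is trivial.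
\<close>

definition \<F> :: "enat \<Rightarrow> (nat \<Rightarrow> bool) measure" where
  "\<F> t = sigma UNIV {X i -` A | i A. 1 \<le> i \<and> enat i \<le> t}"

definition adapted :: "(nat \<Rightarrow> (nat \<Rightarrow> bool) \<Rightarrow> real) \<Rightarrow> bool" where
  "adapted M \<longleftrightarrow> (\<forall>t. M t \<in> borel_measurable (\<F> (enat t)))"

text \<open>
  The conditional expectation is the \<^typ>\<open>ennreal\<close>-valued one, which is meaningful for every
  nonnegative variable without an integrability assumption.
\<close>

definition NSM :: "(nat \<Rightarrow> bool) measure \<Rightarrow> (nat \<Rightarrow> (nat \<Rightarrow> bool) \<Rightarrow> real) \<Rightarrow> bool" where
  "NSM Q M \<longleftrightarrow>
     adapted M \<and>
     (\<forall>t \<omega>. 0 \<le> M t \<omega>) \<and>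
     (\<forall>\<omega>. M 0 \<omega> = 1) \<and>
     (\<forall>s t. s \<le> t \<longrightarrow>
        (AE \<omega> in Q. nn_cond_exp Q (\<F> (enat s)) (\<lambda>\<omega>'. ennreal (M t \<omega>')) \<omega> \<le> ennreal (M s \<omega>)))"

definition NSM_set :: "(nat \<Rightarrow> bool) measure set \<Rightarrow> (nat \<Rightarrow> (nat \<Rightarrow> bool) \<Rightarrow> real) \<Rightarrow> bool" where
  "NSM_set \<Q> M \<longleftrightarrow> (\<forall>Q\<in>\<Q>. NSM Q M)"

definition stopped_value ::
  "(nat \<Rightarrow> (nat \<Rightarrow> bool) \<Rightarrow> real) \<Rightarrow> ((nat \<Rightarrow> bool) \<Rightarrow> enat) \<Rightarrow> (nat \<Rightarrow> bool) \<Rightarrow> ennreal" where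
  "stopped_value E \<tau> \<omega> =
     (case \<tau> \<omega> of enat t \<Rightarrow> ennreal (E t \<omega>) | \<infinity> \<Rightarrow> limsup (\<lambda>t. ennreal (E t \<omega>)))"

definition safe_e_process ::
  "(nat \<Rightarrow> bool) measure set \<Rightarrow> (nat \<Rightarrow> (nat \<Rightarrow> bool) \<Rightarrow> real) \<Rightarrow> bool" where
  "safe_e_process \<Q> E \<longleftrightarrow>
     adapted E \<and>
     (\<forall>t \<omega>. 0 \<le> E t \<omega>) \<and>
     (SUP Q\<in>\<Q>. SUP \<tau>\<in>{\<tau>. stopping_time \<F> \<tau>}. \<integral>\<^sup>+\<omega>. stopped_value E \<tau> \<omega> \<partial>Q) \<le> 1"

definition test_time ::
  "(nat \<Rightarrow> (nat \<Rightarrow> bool) \<Rightarrow> real) \<Rightarrow> real \<Rightarrow> (nat \<Rightarrow> bool) \<Rightarrow> enat" where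
  "test_time E \<alpha> \<omega> = Inf {enat t | t. 1 \<le> t \<and> E t \<omega> \<ge> 1 / \<alpha>}"

definition nontrivial_power :: "(nat \<Rightarrow> (nat \<Rightarrow> bool) \<Rightarrow> real) \<Rightarrow> bool" where
  "nontrivial_power E \<longleftrightarrow>
     (\<exists>P\<in>laws. \<exists>\<alpha>\<in>{0<..<1}. \<P>(\<omega> in P. test_time E \<alpha> \<omega> < \<infinity>) > \<alpha>)"

definition powerless_against ::
  "(nat \<Rightarrow> bool) measure \<Rightarrow> (nat \<Rightarrow> (nat \<Rightarrow> bool) \<Rightarrow> real) \<Rightarrow> bool" where
  "powerless_against P E \<longleftrightarrow>
     (\<forall>\<alpha>\<in>{0<..<1}. \<P>(\<omega> in P. test_time E \<alpha> \<omega> < \<infinity>) \<le> \<alpha>)"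

definition Ber_inf :: "real \<Rightarrow> (nat \<Rightarrow> bool) measure" where
  "Ber_inf p = (\<Pi>\<^sub>M i\<in>UNIV. measure_pmf (bernoulli_pmf p))"

text \<open>
  The transition kernel \<open>K\<close> maps the last \<open>k\<close> values, in chronological order, to the distribution of
  the next one. It does not depend on \<open>t\<close> (time-homogeneity), and the joint distribution of the
  first \<open>k\<close> values is arbitrary.
\<close>

definition markov_laws :: "nat \<Rightarrow> (nat \<Rightarrow> bool) measure set" where
  "markov_laws k = {P \<in> laws. \<exists>K :: bool list \<Rightarrow> bool pmf. \<forall>t\<ge>k. \<forall>y.
     AE \<omega> in P. real_cond_exp P (\<F> (enat t)) (indicator {\<omega>'. X (t + 1) \<omega>' = y}) \<omega> =
       pmf (K (map (\<lambda>i. X i \<omega>) [t + 1 - k..<t + 1])) y}"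

end

theory Submission
  imports Defs
begin

text \<open>
  A \<open>\<Q>\<close>-NSM is pointwise nonincreasing. Integrating its defining inequality under \<open>Ber(p)\<close> over a
  cylinder of length \<open>s\<close> gives \<open>q * M (s + 1) \<omega> \<le> M s \<omega>\<close>, where \<open>q\<close> is the probability
  of the next symbol of \<open>\<omega>\<close>; now let \<open>q\<close> tend to 1. A nonincreasing process is an NSM under
  every law and stays below its initial value 1, hence never reaches \<open>1 / \<alpha>\<close>.
\<close>

lemma space_\<F> [simp]: "space (\<F> t) = UNIV"
  by (simp add: \<F>_def)

lemma sets_\<F>: "sets (\<F> t) = sigma_sets UNIV {X i -` A | i A. 1 \<le> i \<and> enat i \<le> t}"
  by (simp add: \<F>_def)

text \<open>The defining properties of \<open>nn_cond_exp\<close> hold only over a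
  sub-sigma-algebra; otherwise it is 0 by default.\<close>

lemma subalgebra_\<F>:
  assumes "sets Q = sets seq_space"
  shows "subalgebra Q (\<F> t)"
proof -
  have space: "space Q = UNIV"
    using sets_eq_imp_space_eq[OF assms] by (simp add: seq_space_def space_PiM)
  have "X i -` A \<in> sets Q" for i A
  proof -
    have "(\<lambda>\<omega>. \<omega> (i - 1)) \<in> measurable seq_space (count_space UNIV)"
      unfolding seq_space_def by measurable
    then have "(\<lambda>\<omega>. \<omega> (i - 1)) -` A \<inter> space seq_space \<in> sets seq_space"
      by (rule measurable_sets) simp
    then show ?thesis
      using space by (simp add: assms X_def[abs_def] seq_space_def space_PiM)
  qed
  then have "sigma_sets (space Q) {X i -` A | i A. 1 \<le> i \<and> enat i \<le> t} \<subseteq> sets Q"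
    by (intro sets.sigma_sets_subset) auto
  then show ?thesis
    by (simp add: subalgebra_def space sets_\<F>)
qed

text \<open>The sets that ignore all positions from \<open>t\<close> on are closed under complement
  and countable union, so only the generators need checking.\<close>

lemma \<F>_set_determined:
  assumes "A \<in> sets (\<F> (enat t))" and "\<And>i. i < t \<Longrightarrow> \<omega> i = \<omega>' i"
  shows "\<omega> \<in> A \<longleftrightarrow> \<omega>' \<in> A"
  using assms(1) unfolding sets_\<F>
proof induction
  case (Basic a)
  then obtain i A where i: "a = X i -` A" "1 \<le> i" "i \<le> t"
    by auto
  \<comment> \<open>\<open>X i\<close> reads position \<open>i - 1\<close>, and
    \<open>1 \<le> i \<le> t\<close> gives \<open>i - 1 < t\<close>.\<close>
  with assms(2)[of "i - 1"] show ?case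
    by (simp add: X_def)
qed simp_all

text \<open>The level set of \<open>M t\<close> through \<open>\<omega>\<close> lies in
  \<open>\<F> (enat t)\<close>, so it contains \<open>\<omega>'\<close> along with
  \<open>\<omega>\<close>.\<close>

lemma adapted_determined:
  assumes "adapted M" and "\<And>i. i < t \<Longrightarrow> \<omega> i = \<omega>' i"
  shows "M t \<omega> = M t \<omega>'"
proof -
  have "M t \<in> borel_measurable (\<F> (enat t))"
    using assms(1) by (simp add: adapted_def)
  then have "M t -` {M t \<omega>} \<inter> space (\<F> (enat t)) \<in> sets (\<F> (enat t))"
    by (rule measurable_sets) simp
  from \<F>_set_determined[OF this, of \<omega> \<omega>'] assms(2) show ?thesis
    by simp
qed

text \<open>This is the atom of \<open>\<F> (enat s)\<close> around \<open>\<omega>\<close>. An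
  adapted process is constant on it at time \<open>s\<close>, so its integral there is value times
  measure.\<close>

definition cylinder :: "nat \<Rightarrow> (nat \<Rightarrow> bool) \<Rightarrow> (nat \<Rightarrow> bool) set" where
  "cylinder s \<omega> = {\<omega>'. \<forall>i<s. \<omega>' i = \<omega> i}"

lemma cylinder_in_\<F>: "cylinder s \<omega> \<in> sets (\<F> (enat s))"
proof -
  have "{\<omega>' \<in> space (\<F> (enat s)). \<omega>' i = \<omega> i} \<in> sets (\<F> (enat s))" if "i \<in> {..<s}" for i
  proof -
    have "X (Suc i) -` {\<omega> i} \<in> sets (\<F> (enat s))"
      unfolding sets_\<F> using that
      by (intro sigma_sets.Basic CollectI exI[of _ "Suc i"] exI[of _ "{\<omega> i}"]) simp
    then show ?thesis
      by (simp add: X_def[abs_def] vimage_def)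
  qed
  then have "{\<omega>' \<in> space (\<F> (enat s)). \<forall>i\<in>{..<s}. \<omega>' i = \<omega> i} \<in> sets (\<F> (enat s))"
    by (intro sets.sets_Collect_finite_All) simp_all
  then show ?thesis
    by (simp add: cylinder_def Ball_def)
qed

lemma Ber_inf_in_laws: "Ber_inf p \<in> laws"
proof -
  interpret product_prob_space "\<lambda>_::nat. measure_pmf (bernoulli_pmf p)" UNIV
    by unfold_locales
  \<comment> \<open>In both products every subset of each factor is measurable.\<close>
  have "sets (Ber_inf p) = sets seq_space"
    unfolding Ber_inf_def seq_space_def by (intro sets_PiM_cong) auto
  then show ?thesis
    using prob_space_axioms by (simp add: laws_def Ber_inf_def)
qed

lemma emeasure_Ber_inf_cylinder:
  "emeasure (Ber_inf p) (cylinder s \<omega>) = (\<Prod>i<s. ennreal (pmf (bernoulli_pmf p) (\<omega> i)))"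
proof -
  interpret product_prob_space "\<lambda>_::nat. measure_pmf (bernoulli_pmf p)" UNIV
    by unfold_locales
  have "emeasure (Ber_inf p) {x\<in>space (Ber_inf p). \<forall>i\<in>{..<s}. x i \<in> {\<omega> i}} =
      (\<Prod>i<s. emeasure (measure_pmf (bernoulli_pmf p)) {\<omega> i})"
    unfolding Ber_inf_def by (rule emeasure_PiM_Collect) auto
  also have "{x\<in>space (Ber_inf p). \<forall>i\<in>{..<s}. x i \<in> {\<omega> i}} = cylinder s \<omega>"
    by (auto simp: cylinder_def Ber_inf_def space_PiM)
  finally show ?thesis
    by (simp add: emeasure_pmf_single)
qed

text \<open>For \<open>p\<close> strictly between 0 and 1 every cylinder has positive probability,
  so an almost sure inequality yields a bound at every single \<open>\<omega>\<close>.\<close>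

lemma NSM_Ber_inf_step:
  assumes NSM: "NSM (Ber_inf p) M" and p: "0 < p" "p < 1"
  shows "pmf (bernoulli_pmf p) (\<omega> s) * M (Suc s) \<omega> \<le> M s \<omega>"
proof -
  let ?Q = "Ber_inf p" and ?C = "cylinder s \<omega>" and ?D = "cylinder (Suc s) \<omega>"
  let ?q = "pmf (bernoulli_pmf p) (\<omega> s)"
  have Q: "prob_space ?Q" and sets: "sets ?Q = sets seq_space"
    using Ber_inf_in_laws by (auto simp: laws_def)
  interpret prob_space ?Q by (rule Q)
  interpret finite_measure_subalgebra ?Q "\<F> (enat s)"
    by unfold_locales (rule subalgebra_\<F>[OF sets])
  have adapted: "adapted M" and nonneg: "\<And>t \<omega>. 0 \<le> M t \<omega>"
    and cond: "AE \<omega> in ?Q. nn_cond_exp ?Q (\<F> (enat s)) (\<lambda>\<omega>'. ennreal (M (Suc s) \<omega>')) \<omega> \<le> ennreal (M s \<omega>)"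
    using NSM by (auto simp: NSM_def)
  have meas: "M t \<in> borel_measurable ?Q" for t
    using adapted measurable_from_subalg[OF subalgebra_\<F>[OF sets]] by (auto simp: adapted_def)
  have [measurable]: "(\<lambda>\<omega>. ennreal (M t \<omega>)) \<in> borel_measurable ?Q" for t
    using meas by measurable
  have C\<F>: "?C \<in> Sigma_Algebra.sets (\<F> (enat s))" by (rule cylinder_in_\<F>)
  have cyl: "cylinder t \<omega> \<in> Sigma_Algebra.sets ?Q" for t
    using cylinder_in_\<F>[of t \<omega>] subalgebra_\<F>[OF sets, of "enat t"] by (auto simp: subalgebra_def)
  have const: "M t x = M t \<omega>" if "x \<in> cylinder t \<omega>" for t x
    using that by (intro adapted_determined[OF adapted]) (simp add: cylinder_def)
  have "ennreal (M (Suc s) \<omega>) * emeasure ?Q ?D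
      = (\<integral>\<^sup>+x. ennreal (M (Suc s) \<omega>) * indicator ?D x \<partial>?Q)"
    using cyl by (simp add: nn_integral_cmult_indicator)
  also have "\<dots> = (\<integral>\<^sup>+x. ennreal (M (Suc s) x) * indicator ?D x \<partial>?Q)"
    by (intro nn_integral_cong) (auto simp: indicator_def dest: const)
  \<comment> \<open>The next symbol splits \<open>?C\<close> into \<open>?D\<close> and a sibling
    cylinder, whose nonnegative contribution is dropped here.\<close>
  also have "\<dots> \<le> (\<integral>\<^sup>+x\<in>?C. ennreal (M (Suc s) x) \<partial>?Q)"
    by (intro nn_integral_mono) (auto simp: cylinder_def indicator_def)
  \<comment> \<open>Since \<open>?C\<close> lies in \<open>\<F> (enat s)\<close>, its indicator is a
    valid test function for the conditional expectation.\<close>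
  also have "\<dots> = (\<integral>\<^sup>+x\<in>?C. nn_cond_exp ?Q (\<F> (enat s)) (\<lambda>\<omega>'. ennreal (M (Suc s) \<omega>')) x \<partial>?Q)"
    using nn_cond_exp_intg[of "indicator ?C" "\<lambda>x. ennreal (M (Suc s) x)"] C\<F>
    by (simp add: mult.commute)
  also have "\<dots> \<le> (\<integral>\<^sup>+x\<in>?C. ennreal (M s x) \<partial>?Q)"
    using cond by (intro nn_integral_mono_AE) (auto simp: indicator_def)
  also have "\<dots> = (\<integral>\<^sup>+x. ennreal (M s \<omega>) * indicator ?C x \<partial>?Q)"
    by (intro nn_integral_cong) (auto simp: indicator_def dest: const)
  also have "\<dots> = ennreal (M s \<omega>) * emeasure ?Q ?C"
    using cyl by (simp add: nn_integral_cmult_indicator)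
  finally have le: "ennreal (M (Suc s) \<omega>) * emeasure ?Q ?D \<le> ennreal (M s \<omega>) * emeasure ?Q ?C" .
  \<comment> \<open>By independence \<open>?D\<close> has probability \<open>c * ?q\<close>, where
    \<open>c\<close> is that of \<open>?C\<close>; positivity of \<open>c\<close> allows it to be
    cancelled.\<close>
  define c where "c = (\<Prod>i<s. pmf (bernoulli_pmf p) (\<omega> i))"
  have "pmf (bernoulli_pmf p) b > 0" for b
    using p by (cases b) auto
  then have c: "c > 0" unfolding c_def by (intro prod_pos) auto
  have C: "emeasure ?Q ?C = ennreal c" and D: "emeasure ?Q ?D = ennreal (c * ?q)"
    by (simp_all add: emeasure_Ber_inf_cylinder c_def prod_ennreal prod_nonneg ennreal_mult)
  have "M (Suc s) \<omega> * (c * ?q) \<le> M s \<omega> * c"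
    using le c nonneg by (simp add: C D flip: ennreal_mult)
  then show ?thesis
    using c by (simp add: algebra_simps)
qed

lemma NSM_Ber_inf_antimono:
  assumes "\<And>p. 0 < p \<Longrightarrow> p < 1 \<Longrightarrow> NSM (Ber_inf p) M" and "s \<le> t"
  shows "M t \<omega> \<le> M s \<omega>"
proof -
  have "M (Suc s) \<omega> \<le> M s \<omega>" for s
  proof -
    \<comment> \<open>Here all the Bernoulli laws are used at once: the parameter, \<open>q\<close>
      or \<open>1 - q\<close>, is chosen so that the actual next symbol of \<open>\<omega>\<close>
      has probability \<open>q\<close>.\<close>
    have "q * M (Suc s) \<omega> \<le> M s \<omega>" if "0 < q" "q < 1" for q
    proof (cases "\<omega> s")
      case True
      then show ?thesis
        using NSM_Ber_inf_step[OF assms(1), of q \<omega> s] that by simp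
    next
      case False
      then show ?thesis
        using NSM_Ber_inf_step[OF assms(1), of "1 - q" \<omega> s] that by simp
    qed
    moreover have "0 \<le> M (Suc s) \<omega>" "0 \<le> M s \<omega>"
      using assms(1)[of "1/2"] by (auto simp: NSM_def)
    \<comment> \<open>This is the limit of \<open>q\<close> tending to 1, taken without
      topology.\<close>
    ultimately show ?thesis
      using field_le_mult_one_interval by blast
  qed
  then have "decseq (\<lambda>t. M t \<omega>)"
    by (rule decseq_SucI)
  then show ?thesis
    using assms(2) by (rule decseqD)
qed

text \<open>Conditional expectation is monotone and fixes \<open>M s\<close>, which is already
  measurable at time \<open>s\<close>; this works under any law.\<close>

lemma antimono_imp_NSM:
  assumes P: "P \<in> laws" and adapted: "adapted M"
    and nonneg: "\<And>t \<omega>. 0 \<le> M t \<omega>" and init: "\<And>\<omega>. M 0 \<omega> = 1"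
    and mono: "\<And>s t \<omega>. s \<le> t \<Longrightarrow> M t \<omega> \<le> M s \<omega>"
  shows "NSM P M"
proof -
  have "AE \<omega> in P. nn_cond_exp P (\<F> (enat s)) (\<lambda>\<omega>'. ennreal (M t \<omega>')) \<omega> \<le> ennreal (M s \<omega>)"
    if "s \<le> t" for s t
  proof -
    have sets: "sets P = sets seq_space" and "prob_space P"
      using P by (auto simp: laws_def)
    then interpret prob_space P by simp
    interpret finite_measure_subalgebra P "\<F> (enat s)"
      by unfold_locales (rule subalgebra_\<F>[OF sets])
    have M\<F>: "M r \<in> borel_measurable (\<F> (enat r))" for r
      using adapted by (simp add: adapted_def)
    then have [measurable]: "M r \<in> borel_measurable P" for r
      using measurable_from_subalg[OF subalgebra_\<F>[OF sets]] by blast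
    have "AE \<omega> in P. nn_cond_exp P (\<F> (enat s)) (\<lambda>\<omega>'. ennreal (M t \<omega>')) \<omega>
        \<le> nn_cond_exp P (\<F> (enat s)) (\<lambda>\<omega>'. ennreal (M s \<omega>')) \<omega>"
      using mono[OF that] by (intro nn_cond_exp_mono) (auto intro: ennreal_leI)
    moreover have "AE \<omega> in P. ennreal (M s \<omega>) = nn_cond_exp P (\<F> (enat s)) (\<lambda>\<omega>'. ennreal (M s \<omega>')) \<omega>"
      using M\<F>[of s] by (intro nn_cond_exp_F_meas) simp
    ultimately show ?thesis
      by eventually_elim simp
  qed
  then show ?thesis
    using adapted nonneg init by (auto simp: NSM_def)
qed

lemma le_one_imp_powerless:
  assumes "\<And>t \<omega>. M t \<omega> \<le> 1"
  shows "powerless_against P M"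
  unfolding powerless_against_def
proof
  fix \<alpha> :: real
  assume "\<alpha> \<in> {0<..<1}"
  then have "1 < 1 / \<alpha>" by simp
  then have "\<not> 1 / \<alpha> \<le> M t \<omega>" for t \<omega>
    using assms[of t \<omega>] by linarith
  \<comment> \<open>The infimum of the empty set in \<open>enat\<close> is
    \<open>\<infinity>\<close>.\<close>
  then have "test_time M \<alpha> \<omega> = \<infinity>" for \<omega>
    by (simp add: test_time_def top_enat_def)
  then show "\<P>(\<omega> in P. test_time M \<alpha> \<omega> < \<infinity>) \<le> \<alpha>"
    using \<open>\<alpha> \<in> {0<..<1}\<close> by simp
qed

theorem proposition5:
  fixes \<Q> :: "(nat \<Rightarrow> bool) measure set"
  assumes "\<Q> = {Ber_inf p | p. p \<in> {0..1}}"
  shows "(\<forall>M. NSM_set \<Q> M \<longrightarrow> NSM_set (markov_laws 1) M)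
    \<and> (\<forall>M. NSM_set \<Q> M \<longrightarrow> (\<forall>k. NSM_set (markov_laws k) M))
    \<and> (\<forall>M. NSM_set \<Q> M \<longrightarrow> (\<forall>Ps. Ps \<subseteq> laws \<longrightarrow> NSM_set Ps M))
    \<and> (\<forall>E. safe_e_process \<Q> E \<and> nontrivial_power E \<longrightarrow> \<not> NSM_set \<Q> E)
    \<and> (\<forall>M. NSM_set \<Q> M \<longrightarrow> (\<forall>P\<in>laws. powerless_against P M))"
proof -
  have *: "NSM P M" "powerless_against P M" if M: "NSM_set \<Q> M" and P: "P \<in> laws" for M P
  proof -
    have NSM: "NSM (Ber_inf p) M" if "0 < p" "p < 1" for p
    proof -
      have "Ber_inf p \<in> \<Q>"
        unfolding assms using that by (intro CollectI exI[of _ p]) simp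
      then show ?thesis
        using M by (simp add: NSM_set_def)
    qed
    have mono: "M t \<omega> \<le> M s \<omega>" if "s \<le> t" for s t \<omega>
      using NSM_Ber_inf_antimono[OF NSM that] by simp
    have M': "adapted M" "\<And>t \<omega>. 0 \<le> M t \<omega>" "\<And>\<omega>. M 0 \<omega> = 1"
      using NSM[of "1/2"] by (auto simp: NSM_def)
    show "NSM P M"
      by (rule antimono_imp_NSM[OF P M' mono])
    show "powerless_against P M"
      using mono[of 0] M'(3) by (intro le_one_imp_powerless) simp
  qed
  have laws: "NSM_set Ps M" if "NSM_set \<Q> M" "Ps \<subseteq> laws" for Ps M
    using *(1) that by (auto simp: NSM_set_def)
  have "markov_laws k \<subseteq> laws" for k
    by (auto simp: markov_laws_def)
  \<comment> \<open>Nontrivial power is exactly the failure of powerlessness against some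
    law.\<close>
  moreover have "\<not> NSM_set \<Q> E" if "nontrivial_power E" for E
    using *(2)[of E] that by (fastforce simp: nontrivial_power_def powerless_against_def not_le)
  ultimately show ?thesis
    using laws *(2) by blast
qed

end
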